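(* Let $f:\mathbb{R}\to\mathbb{R}$ be a $2\pi$-periodic function that is continuous and has a continuous derivative. If $\int_0^{2\pi} f(x)\,dx=0$, then $$\int_0^{2\pi}[f(x)]^2\,dx\le\int_0^{2\pi}[f'(x)]^2\,dx.$$ Equality holds if and only if there exist $a,b\in\mathbb{R}$ such that $f(x)=a\cos x+b\sin x$ for all $x\in\mathbb{R}$. *)

theory Defs
  imports "HOL-Analysis.Analysis"
begin

end

theory Submission
  imports Defs
begin

text \<open>
  The proof completes a square and uses no Fourier series. If \<open>g\<close> vanishes at both ends of an
  interval \<open>[c, c + \<pi>]\<close> of half a period, then
  \<open>((g x)\<^sup>2 cot (x - c))' = (g' x)\<^sup>2 - (g x)\<^sup>2 - (g' x - g x cot (x - c))\<^sup>2\<close>,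
  and the function being differentiated extends continuously by zero to both ends, because the
  double zero of \<open>g\<^sup>2\<close> beats the simple pole of the cotangent. Integrating, the integral of
  \<open>(g')\<^sup>2\<close> exceeds that of \<open>g\<^sup>2\<close> by the integral of a square
  (lemma \<open>has_integral_deriv_minus_cot_square\<close>). This is the inequality on the interval;
  equality forces \<open>g' x = g x cot (x - c)\<close>, so that \<open>g\<close> is a multiple of \<open>sin (x - c)\<close>
  (lemma \<open>wirtinger_half_period_equality\<close>).

  For a function \<open>f\<close> of period \<open>2\<pi>\<close> the intermediate value theorem gives a point \<open>c\<close> at which
  \<open>f (c + \<pi>) = f c\<close> (lemma \<open>exists_equal_values_half_period_apart\<close>). With \<open>m = f c\<close>, the function
  \<open>g = f - m\<close> vanishes at \<open>c\<close>, \<open>c + \<pi>\<close> and \<open>c + 2\<pi>\<close>, so the above applies to both halves of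
  the period \<open>[c, c + 2\<pi>]\<close>. Since \<open>f\<close> has mean zero, the integral of \<open>g\<^sup>2\<close> over a period is
  that of \<open>f\<^sup>2\<close> plus \<open>2\<pi>m\<^sup>2\<close>, which gives the inequality for \<open>f\<close>. In the case of equality
  \<open>m = 0\<close>, and \<open>f\<close> is a multiple of \<open>sin (x - c)\<close> on each half; the derivative at the common
  point \<open>c + \<pi>\<close> shows that the two multiples agree.
\<close>

section \<open>Functions vanishing at the ends of a half period\<close>

text \<open>
  At a zero \<open>s\<close> of the sine, \<open>g\<^sup>2 cot\<close> is the product of \<open>g cos\<close>, which tends to zero, and of
  \<open>g / sin\<close>, a ratio of two functions vanishing at \<open>s\<close>, which tends to \<open>g' / cos (s - c)\<close>. The
  limit is therefore zero, and this is also the value at \<open>s\<close>, where \<open>g\<close> is zero.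
\<close>
lemma isCont_square_times_cot:
  fixes g :: "real \<Rightarrow> real" and g' :: real
  assumes deriv: "(g has_real_derivative g') (at s)"
    and zero: "sin (s - c) = 0 \<Longrightarrow> g s = 0"
  shows "isCont (\<lambda>x. (g x)\<^sup>2 * cot (x - c)) s"
proof (cases "sin (s - c) = 0")
  case False
  have "isCont g s"
    using deriv by (rule DERIV_isCont)
  then show ?thesis
    using False unfolding cot_def by (intro continuous_intros) auto
next
  case True
  then have gs: "g s = 0" and cs: "cos (s - c) \<noteq> 0"
    using zero sin_zero_abs_cos_one by fastforce+
  have "((\<lambda>x. sin (x - c)) has_real_derivative cos (s - c)) (at s)"
    by (auto intro!: derivative_eq_intros)
  then have "((\<lambda>x. sin (x - c) / (x - s)) \<longlongrightarrow> cos (s - c)) (at s)"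
    by (simp add: has_field_derivative_iff True)
  moreover have "((\<lambda>x. g x / (x - s)) \<longlongrightarrow> g') (at s)"
    using deriv by (simp add: has_field_derivative_iff gs)
  ultimately have "((\<lambda>x. (g x / (x - s)) / (sin (x - c) / (x - s))) \<longlongrightarrow> g' / cos (s - c)) (at s)"
    using cs by (intro tendsto_divide)
  then have ratio: "((\<lambda>x. g x / sin (x - c)) \<longlongrightarrow> g' / cos (s - c)) (at s)"
    by (rule Lim_transform_eventually) (auto simp: eventually_at_filter)
  have "(g \<longlongrightarrow> 0) (at s)"
    using DERIV_isCont[OF deriv] gs by (simp add: isCont_def)
  moreover have "((\<lambda>x. cos (x - c)) \<longlongrightarrow> cos (s - c)) (at s)"
    by (intro tendsto_intros)
  ultimately have "((\<lambda>x. g x * cos (x - c) * (g x / sin (x - c))) \<longlongrightarrow>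
      0 * cos (s - c) * (g' / cos (s - c))) (at s)"
    using ratio by (intro tendsto_mult)
  then show ?thesis
    by (simp add: isCont_def gs cot_def power2_eq_square mult_ac)
qed

text \<open>
  The fundamental theorem of calculus for \<open>g\<^sup>2 cot\<close>, which is continuous on the closed interval,
  differentiable in its interior and zero at both ends. That the square on the left is integrable
  up to the poles of the cotangent is part of the conclusion.
\<close>
lemma has_integral_deriv_minus_cot_square:
  fixes g g' :: "real \<Rightarrow> real"
  assumes deriv: "\<And>x. x \<in> {c..c + pi} \<Longrightarrow> (g has_real_derivative g' x) (at x)"
    and cont: "continuous_on {c..c + pi} g'"
    and zero: "g c = 0" "g (c + pi) = 0"
  shows "((\<lambda>x. (g' x - g x * cot (x - c))\<^sup>2) has_integral
           (integral {c..c + pi} (\<lambda>x. (g' x)\<^sup>2) - integral {c..c + pi} (\<lambda>x. (g x)\<^sup>2))) {c..c + pi}"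
proof -
  define F where "F = (\<lambda>x. (g x)\<^sup>2 * cot (x - c))"
  have sin_pos: "sin (x - c) > 0" if "x \<in> {c<..<c + pi}" for x
    using that by (intro sin_gt_zero) auto
  have "isCont F x" if "x \<in> {c..c + pi}" for x
    unfolding F_def
  proof (rule isCont_square_times_cot[OF deriv[OF that]])
    show "g x = 0" if "sin (x - c) = 0"
      using that zero sin_pos[of x] \<open>x \<in> {c..c + pi}\<close> by (cases "x = c \<or> x = c + pi") auto
  qed
  then have cont_F: "continuous_on {c..c + pi} F"
    by (intro continuous_at_imp_continuous_on) auto
  have deriv_F: "(F has_vector_derivative
      (g' x)\<^sup>2 - (g x)\<^sup>2 - (g' x - g x * cot (x - c))\<^sup>2) (at x)"
    if x: "x \<in> {c<..<c + pi}" for x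
  proof -
    have s: "sin (x - c) \<noteq> 0"
      using sin_pos[OF x] by simp
    have "((\<lambda>x. x - c) has_real_derivative 1) (at x)"
      by (auto intro!: derivative_eq_intros)
    then have "((\<lambda>x. cot (x - c)) has_real_derivative - inverse ((sin (x - c))\<^sup>2) * 1) (at x)"
      by (rule DERIV_chain2[where f = cot and g = "\<lambda>x. x - c", OF DERIV_cot[OF s]])
    moreover have "inverse ((sin (x - c))\<^sup>2) = 1 + (cot (x - c))\<^sup>2"
      using s sin_cos_squared_add[of "x - c"]
      by (simp add: cot_def power_divide field_simps)
    ultimately have dcot: "((\<lambda>x. cot (x - c)) has_real_derivative - (1 + (cot (x - c))\<^sup>2)) (at x)"
      by simp
    have dg: "(g has_real_derivative g' x) (at x)"
      using x by (intro deriv) auto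
    have "(F has_real_derivative
        (g' x)\<^sup>2 - (g x)\<^sup>2 - (g' x - g x * cot (x - c))\<^sup>2) (at x)"
      unfolding F_def
      by (rule derivative_eq_intros dg dcot refl)+ (simp add: power2_eq_square algebra_simps)
    then show ?thesis
      by (simp add: has_real_derivative_iff_has_vector_derivative)
  qed
  have "continuous_on {c..c + pi} g"
    using deriv DERIV_isCont by (intro continuous_at_imp_continuous_on) blast
  then have int_g: "((\<lambda>x. (g x)\<^sup>2) has_integral integral {c..c + pi} (\<lambda>x. (g x)\<^sup>2)) {c..c + pi}"
    by (intro integrable_integral integrable_continuous_real continuous_intros)
  have int_g': "((\<lambda>x. (g' x)\<^sup>2) has_integral integral {c..c + pi} (\<lambda>x. (g' x)\<^sup>2)) {c..c + pi}"
    using cont by (intro integrable_integral integrable_continuous_real continuous_intros)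
  have "((\<lambda>x. (g' x)\<^sup>2 - (g x)\<^sup>2 - (g' x - g x * cot (x - c))\<^sup>2) has_integral
      F (c + pi) - F c) {c..c + pi}"
    using cont_F deriv_F by (intro fundamental_theorem_of_calculus_interior) auto
  then have int0: "((\<lambda>x. (g' x)\<^sup>2 - (g x)\<^sup>2 - (g' x - g x * cot (x - c))\<^sup>2) has_integral 0) {c..c + pi}"
    by (simp add: F_def zero)
  show ?thesis
    using has_integral_diff[OF has_integral_diff[OF int_g' int_g] int0] by simp
qed

text \<open>
  Continuity is asked for in the interior only, since the lemma is applied to
  \<open>(g' - g cot)\<^sup>2\<close>, which may jump at the ends. The point \<open>x\<close> is enclosed in a smaller
  closed interval on which \<open>h\<close> is continuous; by positivity its integral there is again zero.
\<close>
lemma has_integral_zero_nonneg_continuous_interior: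
  fixes h :: "real \<Rightarrow> real"
  assumes int: "(h has_integral 0) {a..b}"
    and cont: "continuous_on {a<..<b} h"
    and nonneg: "\<And>x. h x \<ge> 0"
    and x: "x \<in> {a<..<b}"
  shows "h x = 0"
proof -
  define p where "p = (a + x) / 2"
  define q where "q = (x + b) / 2"
  have pq: "a < p" "p < x" "x < q" "q < b"
    using x by (auto simp: p_def q_def)
  have "continuous_on {p..q} h"
    using pq by (intro continuous_on_subset[OF cont]) auto
  moreover from this have hi: "(h has_integral integral {p..q} h) {p..q}"
    by (intro integrable_integral integrable_continuous_real)
  moreover have "integral {p..q} h \<le> 0"
    using pq by (intro has_integral_subset_le[OF _ hi int]) (auto simp: nonneg)
  moreover have "integral {p..q} h \<ge> 0"
    using hi nonneg by (rule has_integral_nonneg)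
  ultimately show ?thesis
    using pq nonneg has_integral_0_cbox_imp_0[of p q h x] by auto
qed

lemma wirtinger_half_period:
  fixes g g' :: "real \<Rightarrow> real"
  assumes deriv: "\<And>x. x \<in> {c..c + pi} \<Longrightarrow> (g has_real_derivative g' x) (at x)"
    and cont: "continuous_on {c..c + pi} g'"
    and zero: "g c = 0" "g (c + pi) = 0"
  shows "integral {c..c + pi} (\<lambda>x. (g x)\<^sup>2) \<le> integral {c..c + pi} (\<lambda>x. (g' x)\<^sup>2)"
  using has_integral_nonneg[OF has_integral_deriv_minus_cot_square[OF assms]] by simp

text \<open>
  Equality makes the square \<open>(g' - g cot)\<^sup>2\<close> vanish, which says that \<open>g / sin\<close> has zero derivative.
  The values of \<open>g'\<close> at the two ends are recorded because they allow the multiples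
  of the sine found on adjacent intervals to be compared.
\<close>
lemma wirtinger_half_period_equality:
  fixes g g' :: "real \<Rightarrow> real"
  assumes deriv: "\<And>x. x \<in> {c..c + pi} \<Longrightarrow> (g has_real_derivative g' x) (at x)"
    and cont: "continuous_on {c..c + pi} g'"
    and zero: "g c = 0" "g (c + pi) = 0"
    and eq: "integral {c..c + pi} (\<lambda>x. (g x)\<^sup>2) = integral {c..c + pi} (\<lambda>x. (g' x)\<^sup>2)"
  obtains A where "\<And>x. x \<in> {c..c + pi} \<Longrightarrow> g x = A * sin (x - c)" "g' c = A" "g' (c + pi) = - A"
proof -
  \<comment> \<open>the constant value of \<open>g x / sin (x - c)\<close>, read off at the midpoint, where the sine is 1\<close>
  define A where "A = g (c + pi / 2)"
  have sin_pos: "sin (x - c) > 0" if "x \<in> {c<..<c + pi}" for x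
    using that by (intro sin_gt_zero) auto
  have int0: "((\<lambda>x. (g' x - g x * cot (x - c))\<^sup>2) has_integral 0) {c..c + pi}"
    using has_integral_deriv_minus_cot_square[OF deriv cont zero] eq by simp
  have "isCont g x" if "x \<in> {c..c + pi}" for x
    using deriv[OF that] by (rule DERIV_isCont)
  then have cont_g: "continuous_on {c<..<c + pi} g"
    by (intro continuous_at_imp_continuous_on) auto
  have cont_g': "continuous_on {c<..<c + pi} g'"
    by (rule continuous_on_subset[OF cont]) auto
  have cont_h: "continuous_on {c<..<c + pi} (\<lambda>x. (g' x - g x * cot (x - c))\<^sup>2)"
    unfolding cot_def using sin_pos
    by (intro continuous_intros cont_g cont_g') force
  have ode: "g' x = g x * cot (x - c)" if x: "x \<in> {c<..<c + pi}" for x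
    using has_integral_zero_nonneg_continuous_interior[OF int0 cont_h _ x] by simp
  have interior: "g x = A * sin (x - c)" if x: "x \<in> {c<..<c + pi}" for x
  proof -
    have "((\<lambda>x. g x / sin (x - c)) has_real_derivative 0) (at y)" if y: "y \<in> {c<..<c + pi}" for y
    proof -
      have dg: "(g has_real_derivative g' y) (at y)"
        using y by (intro deriv) auto
      have "g' y * sin (y - c) = g y * cos (y - c)"
        using ode[OF y] sin_pos[OF y] by (simp add: cot_def)
      then show ?thesis
        using sin_pos[OF y] by (auto intro!: derivative_eq_intros dg)
    qed
    then have "g x / sin (x - c) = g (c + pi / 2) / sin (c + pi / 2 - c)"
      using x by (intro DERIV_isconst3[of c "c + pi"]) auto
    then show ?thesis
      using sin_pos[OF x] by (simp add: A_def field_simps)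
  qed
  have g_eq: "g x = A * sin (x - c)" if "x \<in> {c..c + pi}" for x
    using interior[of x] that zero by (cases "x = c \<or> x = c + pi") auto
  \<comment> \<open>at the two ends the formula for \<open>g\<close> is one-sided, but it still determines the derivative\<close>
  have g'_eq: "g' x = A * cos (x - c)" if x: "x \<in> {c..c + pi}" for x
  proof (rule vector_derivative_unique_within_closed_interval[of c "c + pi" x])
    show "(g has_vector_derivative g' x) (at x within cbox c (c + pi))"
      using deriv[OF x] by (simp add: has_real_derivative_iff_has_vector_derivative
        has_vector_derivative_at_within)
    have "((\<lambda>x. A * sin (x - c)) has_vector_derivative A * cos (x - c)) (at x within cbox c (c + pi))"
      unfolding has_real_derivative_iff_has_vector_derivative[symmetric]
      by (auto intro!: derivative_eq_intros)
    then show "(g has_vector_derivative A * cos (x - c)) (at x within cbox c (c + pi))"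
      using x g_eq by (rule_tac has_vector_derivative_transform) auto
  qed (use x in auto)
  show thesis
    using that[OF g_eq] g'_eq[of c] g'_eq[of "c + pi"] by simp
qed

section \<open>Periodic functions\<close>

lemma integral_periodic_shift:
  fixes h :: "real \<Rightarrow> real"
  assumes periodic: "\<And>x. h (x + T) = h x"
    and cont: "continuous_on UNIV h"
    and c: "0 \<le> c" "c \<le> T"
  shows "integral {c..c + T} h = integral {0..T} h"
proof -
  have int: "h integrable_on {a..b}" for a b
    by (rule integrable_continuous_real) (rule continuous_on_subset[OF cont], simp)
  have "h \<circ> (+) T = h"
    using periodic by (auto simp: fun_eq_iff add.commute)
  then have "integral {T..c + T} h = integral {0..c} h"
    using integral_shift_Icc_real[of 0 c h T] by simp
  moreover have "integral {c..c + T} h = integral {c..T} h + integral {T..c + T} h"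
    using c by (intro Henstock_Kurzweil_Integration.integral_combine[symmetric] int) auto
  moreover have "integral {0..T} h = integral {0..c} h + integral {c..T} h"
    using c by (intro Henstock_Kurzweil_Integration.integral_combine[symmetric] int) auto
  ultimately show ?thesis
    by simp
qed

text \<open>
  The difference \<open>d x = f (x + T) - f x\<close> satisfies \<open>d T = - d 0\<close>, so it changes sign
  on \<open>[0, T]\<close>.
\<close>
lemma exists_equal_values_half_period_apart:
  fixes f :: "real \<Rightarrow> real"
  assumes periodic: "\<And>x. f (x + 2 * T) = f x"
    and cont: "continuous_on UNIV f"
    and T: "T \<ge> 0"
  obtains c where "0 \<le> c" "c \<le> T" "f (c + T) = f c"
proof -
  define d where "d = (\<lambda>x. f (x + T) - f x)"
  have cont_d: "continuous_on {0..T} d"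
    unfolding d_def
    by (intro continuous_intros continuous_on_compose2[OF cont] continuous_on_subset[OF cont]) auto
  have "d T = - d 0"
    using periodic[of 0] by (simp add: d_def flip: mult_2)
  then consider "d 0 \<le> 0 \<and> 0 \<le> d T" | "d T \<le> 0 \<and> 0 \<le> d 0"
    by linarith
  then obtain c where "0 \<le> c" "c \<le> T" "d c = 0"
    using IVT'[of d 0 0 T] IVT2'[of d T 0 0] cont_d T by metis
  then show thesis
    using that by (simp add: d_def)
qed

lemma periodic_eqI:
  fixes f g :: "real \<Rightarrow> real"
  assumes T: "T > 0"
    and f: "\<And>x. f (x + T) = f x" and g: "\<And>x. g (x + T) = g x"
    and eq: "\<And>x. x \<in> {c..c + T} \<Longrightarrow> f x = g x"
  shows "f x = g x"
proof -
  interpret f: periodic_fun_simple f T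
    by standard (rule f)
  interpret g: periodic_fun_simple g T
    by standard (rule g)
  define n where "n = \<lfloor>(x - c) / T\<rfloor>"
  have "of_int n \<le> (x - c) / T" "(x - c) / T < of_int n + 1"
    unfolding n_def by linarith+
  then have "x - of_int n * T \<in> {c..c + T}"
    using T by (simp add: field_simps)
  then have "f (x - of_int n * T) = g (x - of_int n * T)"
    by (rule eq)
  then show ?thesis
    by (simp add: f.minus_of_int g.minus_of_int)
qed

lemma deriv_periodic:
  fixes f f' :: "real \<Rightarrow> real"
  assumes periodic: "\<And>x. f (x + T) = f x"
    and deriv: "\<And>x. (f has_real_derivative f' x) (at x)"
  shows "f' (x + T) = f' x"
proof -
  have "((\<lambda>x. f (x + T)) has_real_derivative f' (x + T)) (at x)"
    using deriv[of "x + T"] by (simp add: DERIV_shift)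
  then show ?thesis
    using deriv[of x] DERIV_unique by (simp add: periodic)
qed

section \<open>Wirtinger's inequality\<close>

text \<open>
  Here \<open>f'\<close> is the derivative of \<open>f\<close> and the second derivative is \<open>- f\<close>, so
  \<open>(f')\<^sup>2 - f\<^sup>2\<close> is the derivative of the periodic function \<open>f f'\<close>.
\<close>
lemma trig_energy_equality:
  fixes a b :: real
  defines "f \<equiv> \<lambda>x. a * cos x + b * sin x" and "f' \<equiv> \<lambda>x. b * cos x - a * sin x"
  shows "integral {0..2 * pi} (\<lambda>x. (f x)\<^sup>2) = integral {0..2 * pi} (\<lambda>x. (f' x)\<^sup>2)"
proof -
  have "((\<lambda>x. f x * f' x) has_vector_derivative (f' x)\<^sup>2 - (f x)\<^sup>2) (at x within {0..2 * pi})" for x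
    unfolding has_real_derivative_iff_has_vector_derivative[symmetric] f_def f'_def
    by (auto intro!: derivative_eq_intros simp: power2_eq_square algebra_simps)
  then have "((\<lambda>x. (f' x)\<^sup>2 - (f x)\<^sup>2) has_integral (f (2 * pi) * f' (2 * pi) - f 0 * f' 0)) {0..2 * pi}"
    by (intro fundamental_theorem_of_calculus) auto
  then have "integral {0..2 * pi} (\<lambda>x. (f' x)\<^sup>2 - (f x)\<^sup>2) = 0"
    by (simp add: integral_unique f_def f'_def)
  moreover have "(\<lambda>x. (f x)\<^sup>2) integrable_on {0..2 * pi}" "(\<lambda>x. (f' x)\<^sup>2) integrable_on {0..2 * pi}"
    unfolding f_def f'_def by (intro integrable_continuous_real continuous_intros)+
  ultimately show ?thesis
    by (simp add: Henstock_Kurzweil_Integration.integral_diff)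
qed

theorem theorem5p1:
  fixes f :: "real \<Rightarrow> real"
  assumes periodic: "\<And>x. f (x + 2 * pi) = f x"
    and cont: "continuous_on UNIV f"
    and diff: "f differentiable_on UNIV"
    and cont_deriv: "continuous_on UNIV (deriv f)"
    and mean_zero: "integral {0..2 * pi} f = 0"
  shows "integral {0..2 * pi} (\<lambda>x. (f x)\<^sup>2) \<le> integral {0..2 * pi} (\<lambda>x. (deriv f x)\<^sup>2)
    \<and> (integral {0..2 * pi} (\<lambda>x. (f x)\<^sup>2) = integral {0..2 * pi} (\<lambda>x. (deriv f x)\<^sup>2)
         \<longleftrightarrow> (\<exists>a b. \<forall>x. f x = a * cos x + b * sin x))"
proof -
  have df: "(f has_real_derivative deriv f x) (at x)" for x
    using diff by (simp add: differentiable_on_def DERIV_deriv_iff_real_differentiable)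
  obtain c where c: "0 \<le> c" "c \<le> pi" and fc: "f (c + pi) = f c"
    using exists_equal_values_half_period_apart[OF periodic cont] pi_ge_zero by blast
  define m where "m = f c"
  define g where "g = (\<lambda>x. f x - m)"
  have dg: "(g has_real_derivative deriv f x) (at x)" for x
    unfolding g_def by (auto intro!: derivative_eq_intros df)
  have zeros: "g c = 0" "g (c + pi) = 0" "g (c + pi + pi) = 0"
    using fc periodic[of c] by (simp_all add: g_def m_def add.assoc flip: mult_2)
  have cont_g: "continuous_on UNIV g"
    unfolding g_def by (intro continuous_intros cont)
  have cont_f': "continuous_on S (deriv f)" for S
    by (rule continuous_on_subset[OF cont_deriv]) simp
  define D1 where "D1 = integral {c..c + pi} (\<lambda>x. (deriv f x)\<^sup>2)"
  define D2 where "D2 = integral {c + pi..c + pi + pi} (\<lambda>x. (deriv f x)\<^sup>2)"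
  define G1 where "G1 = integral {c..c + pi} (\<lambda>x. (g x)\<^sup>2)"
  define G2 where "G2 = integral {c + pi..c + pi + pi} (\<lambda>x. (g x)\<^sup>2)"
  have le1: "G1 \<le> D1"
    unfolding G1_def D1_def using zeros by (intro wirtinger_half_period dg cont_f')
  have le2: "G2 \<le> D2"
    unfolding G2_def D2_def using zeros by (intro wirtinger_half_period dg cont_f')

  have halves: "integral {0..2 * pi} h = integral {c..c + pi} h + integral {c + pi..c + pi + pi} h"
    if "\<And>x. h (x + 2 * pi) = h x" and h: "continuous_on UNIV h" for h :: "real \<Rightarrow> real"
  proof -
    have "integral {0..2 * pi} h = integral {c..c + pi + pi} h"
      using integral_periodic_shift[OF that, of c] c by (simp add: add.assoc flip: mult_2)
    also have "\<dots> = integral {c..c + pi} h + integral {c + pi..c + pi + pi} h"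
      by (intro Henstock_Kurzweil_Integration.integral_combine[symmetric]
        integrable_continuous_real continuous_on_subset[OF h]) auto
    finally show ?thesis .
  qed
  have D: "integral {0..2 * pi} (\<lambda>x. (deriv f x)\<^sup>2) = D1 + D2"
    unfolding D1_def D2_def using deriv_periodic[OF periodic df]
    by (intro halves continuous_intros cont_f') auto
  have G: "integral {0..2 * pi} (\<lambda>x. (g x)\<^sup>2) = G1 + G2"
    unfolding G1_def G2_def
    by (intro halves continuous_intros cont_g) (simp add: g_def periodic)

  have shift: "integral {0..2 * pi} (\<lambda>x. (g x)\<^sup>2) = integral {0..2 * pi} (\<lambda>x. (f x)\<^sup>2) + 2 * pi * m\<^sup>2"
  proof -
    have f0: "(f has_integral 0) {0..2 * pi}"
      using mean_zero integrable_continuous_real[OF continuous_on_subset[OF cont]]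
      by (metis integrable_integral subset_UNIV)
    have f2: "((\<lambda>x. (f x)\<^sup>2) has_integral integral {0..2 * pi} (\<lambda>x. (f x)\<^sup>2)) {0..2 * pi}"
      by (intro integrable_integral integrable_continuous_real continuous_intros
        continuous_on_subset[OF cont]) auto
    have const: "((\<lambda>x. m\<^sup>2) has_integral 2 * pi * m\<^sup>2) {0..2 * pi}"
      using has_integral_const_real[of "m\<^sup>2" 0 "2 * pi"] by simp
    have "((\<lambda>x. (f x)\<^sup>2 - 2 * m * f x + m\<^sup>2) has_integral
        integral {0..2 * pi} (\<lambda>x. (f x)\<^sup>2) - 2 * m * 0 + 2 * pi * m\<^sup>2) {0..2 * pi}"
      by (intro has_integral_add has_integral_diff f2 const has_integral_mult_right f0)
    then have "integral {0..2 * pi} (\<lambda>x. (f x)\<^sup>2 - 2 * m * f x + m\<^sup>2) =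
        integral {0..2 * pi} (\<lambda>x. (f x)\<^sup>2) + 2 * pi * m\<^sup>2"
      by (simp add: integral_unique)
    then show ?thesis
      by (simp add: g_def power2_diff algebra_simps)
  qed
  have m_nonneg: "2 * pi * m\<^sup>2 \<ge> 0"
    by simp
  have ineq: "integral {0..2 * pi} (\<lambda>x. (f x)\<^sup>2) \<le> integral {0..2 * pi} (\<lambda>x. (deriv f x)\<^sup>2)"
    using D G shift le1 le2 m_nonneg by linarith

  have "\<exists>a b. \<forall>x. f x = a * cos x + b * sin x"
    if eq: "integral {0..2 * pi} (\<lambda>x. (f x)\<^sup>2) = integral {0..2 * pi} (\<lambda>x. (deriv f x)\<^sup>2)"
  proof -
    have eq1: "G1 = D1" and eq2: "G2 = D2" and "2 * pi * m\<^sup>2 = 0"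
      using D G shift le1 le2 m_nonneg eq by linarith+
    then have g_eq: "g = f"
      by (simp add: g_def)
    obtain A where A: "\<And>x. x \<in> {c..c + pi} \<Longrightarrow> g x = A * sin (x - c)" "deriv f (c + pi) = - A"
      using wirtinger_half_period_equality[OF dg cont_f' zeros(1,2)] eq1
      unfolding G1_def D1_def by metis
    obtain B where B: "\<And>x. x \<in> {c + pi..c + pi + pi} \<Longrightarrow> g x = B * sin (x - (c + pi))"
        "deriv f (c + pi) = B"
      using wirtinger_half_period_equality[OF dg cont_f' zeros(2,3)] eq2
      unfolding G2_def D2_def by metis
    have "f x = A * sin (x - c)" for x
    proof (rule periodic_eqI[where f = f and g = "\<lambda>x. A * sin (x - c)" and T = "2 * pi" and c = c])
      show "f y = A * sin (y - c)" if "y \<in> {c..c + 2 * pi}" for y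
      proof (cases "y \<le> c + pi")
        case True
        then show ?thesis
          using A(1)[of y] that g_eq by simp
      next
        case False
        \<comment> \<open>\<open>A\<close> and \<open>B\<close> both determine the derivative at the junction \<open>c + \<pi>\<close>, whence \<open>B = - A\<close>\<close>
        have "sin (y - (c + pi)) = - sin (y - c)"
          by (simp add: diff_diff_eq[symmetric])
        then show ?thesis
          using B(1)[of y] A(2) B(2) False that g_eq by simp
      qed
      show "A * sin (y + 2 * pi - c) = A * sin (y - c)" for y
        using sin_periodic[of "y - c"] by (simp add: algebra_simps)
    qed (use periodic in auto)
    then have "\<forall>x. f x = (- A * sin c) * cos x + (A * cos c) * sin x"
      by (simp add: sin_diff algebra_simps)
    then show ?thesis
      by blast
  qed
  moreover have "integral {0..2 * pi} (\<lambda>x. (f x)\<^sup>2) = integral {0..2 * pi} (\<lambda>x. (deriv f x)\<^sup>2)"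
    if "\<forall>x. f x = a * cos x + b * sin x" for a b
  proof -
    have f: "f = (\<lambda>x. a * cos x + b * sin x)"
      using that by blast
    have "((\<lambda>x. a * cos x + b * sin x) has_real_derivative b * cos x - a * sin x) (at x)" for x
      by (auto intro!: derivative_eq_intros)
    then have "deriv f = (\<lambda>x. b * cos x - a * sin x)"
      unfolding f by (intro ext DERIV_imp_deriv)
    then show ?thesis
      using trig_energy_equality[of a b] by (simp add: f)
  qed
  ultimately show ?thesis
    using ineq by blast
qed

end
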